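(* Let $A$ be a commutative unitary ring, $R$ a commutative monoid, and $\alpha:R\to A$ a morphism of monoids, where $A$ is regarded as a multiplicative monoid. For each $A$-module $U$, the rule $\psi\mapsto\psi\circ\mathrm{d}_{(A,\alpha)}$ defines an isomorphism of $A$-modules, functorial in $U$, $$\eta_U:\mathrm{Hom}_A(\Omega_{(A,\alpha)},U)\to\mathrm{Der}_{(A,\alpha)}(U).$$ Thus $\Omega_{(A,\alpha)}$ represents the functor $\mathrm{Der}_{(A,\alpha)}$. In particular, $(\Omega_{(A,\alpha)},\mathrm{d}_{(A,\alpha)})$ is an initial object in the category $\Phi_{(A,\alpha)}$ of differential $(A,\alpha)$-modules.
   Context: For an $A$-module $U$, a $U$-valued $\alpha$-derivation on $A$ is a function $D:A\to U$ (not assumed additive) such that $D(\alpha(r))=0$ for all $r\in R$ and $D(ab)=aD(b)+bD(a)$ for all $a,b\in A$. $\mathrm{Der}_{(A,\alpha)}(U)$ denotes the set of these, an $A$-module under the pointwise structure induced by $U$; for an $A$-linear $f:U\to V$, $\mathrm{Der}_{(A,\alpha)}(f)(D)=f\circ D$, making $\mathrm{Der}_{(A,\alpha)}$ a functor from $A$-modules to $A$-modules. A differential $(A,\alpha)$-module is a pair $(U,D)$ with $U$ an $A$-module and $D\in\mathrm{Der}_{(A,\alpha)}(U)$; a morphism $(U,D)\to(V,E)$ is an $A$-module morphism $f:U\to V$ with $E=f\circ D$. These form the category $\Phi_{(A,\alpha)}$. Let $X_A$ be the free $A$-module on generators $e_a$, $a\in A$, and let $M_{(A,\alpha)}\subseteq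 X_A$ be the $A$-submodule generated by the elements $e_{\alpha(r)}$ for $r\in R$ and $e_{ab}-ae_b-be_a$ for $a,b\in A$. Put $\Omega_{(A,\alpha)}=X_A/M_{(A,\alpha)}$ and define $\mathrm{d}_{(A,\alpha)}:A\to\Omega_{(A,\alpha)}$ by $\mathrm{d}_{(A,\alpha)}(a)=e_a\bmod M_{(A,\alpha)}$. *)

theory Defs
  imports HOL.Hull "HOL-Algebra.Module" "HOL-Algebra.AbelCoset"
begin

text \<open>Carrier-based conventions: maps between algebraic structures are taken extensional
  (\<^term>\<open>undefined\<close> off the carrier of their domain), so that equality of functions is equality of
  the maps they represent.  A \<^typ>\<open>('a, 'b) module\<close> record also has the fields \<open>mult\<close> and \<open>one\<close>,
  inherited from the record of rings; the \<open>module\<close> locale ignores them, and they are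
  \<^term>\<open>undefined\<close> in the modules constructed below.\<close>


section \<open>Modules over a commutative ring\<close>

definition mod_hom ::
  "('a, 'k) ring_scheme \<Rightarrow> ('a, 'b, 'm) module_scheme \<Rightarrow> ('a, 'c, 'n) module_scheme \<Rightarrow> ('b \<Rightarrow> 'c) set"
  where "mod_hom A M N =
    {f \<in> carrier M \<rightarrow>\<^sub>E carrier N.
      (\<forall>x\<in>carrier M. \<forall>y\<in>carrier M. f (x \<oplus>\<^bsub>M\<^esub> y) = f x \<oplus>\<^bsub>N\<^esub> f y) \<and>
      (\<forall>a\<in>carrier A. \<forall>x\<in>carrier M. f (a \<odot>\<^bsub>M\<^esub> x) = a \<odot>\<^bsub>N\<^esub> f x)}"

definition mod_iso ::
  "('a, 'k) ring_scheme \<Rightarrow> ('a, 'b, 'm) module_scheme \<Rightarrow> ('a, 'c, 'n) module_scheme \<Rightarrow> ('b \<Rightarrow> 'c) set"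
  where "mod_iso A M N = {f \<in> mod_hom A M N. bij_betw f (carrier M) (carrier N)}"

definition pointwise_module ::
  "'x set \<Rightarrow> ('a, 'b, 'm) module_scheme \<Rightarrow> ('x \<Rightarrow> 'b) set \<Rightarrow> ('a, 'x \<Rightarrow> 'b) module"
  where "pointwise_module S U F =
    \<lparr>carrier = F, mult = undefined, one = undefined,
     zero = (\<lambda>x\<in>S. \<zero>\<^bsub>U\<^esub>), add = (\<lambda>f g. \<lambda>x\<in>S. f x \<oplus>\<^bsub>U\<^esub> g x),
     smult = (\<lambda>a f. \<lambda>x\<in>S. a \<odot>\<^bsub>U\<^esub> f x)\<rparr>"

definition Hom_module ::
  "('a, 'k) ring_scheme \<Rightarrow> ('a, 'b, 'm) module_scheme \<Rightarrow> ('a, 'c, 'n) module_scheme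
    \<Rightarrow> ('a, 'b \<Rightarrow> 'c) module"
  where "Hom_module A M U = pointwise_module (carrier M) U (mod_hom A M U)"

text \<open>The covariant functor represented by \<open>M\<close>, on a morphism \<open>f\<close> with domain \<open>U\<close>.\<close>

definition Hom_map ::
  "('a, 'k) ring_scheme \<Rightarrow> ('a, 'b, 'm) module_scheme \<Rightarrow> ('a, 'c, 'n) module_scheme
    \<Rightarrow> ('c \<Rightarrow> 'd) \<Rightarrow> ('b \<Rightarrow> 'c) \<Rightarrow> ('b \<Rightarrow> 'd)"
  where "Hom_map A M U f = (\<lambda>\<psi>\<in>carrier (Hom_module A M U). compose (carrier M) f \<psi>)"

definition quotient_module ::
  "('a, 'b, 'm) module_scheme \<Rightarrow> 'b set \<Rightarrow> ('a, 'b set) module"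
  where "quotient_module X N =
    \<lparr>carrier = a_rcosets\<^bsub>X\<^esub> N, mult = undefined, one = undefined,
     zero = N, add = set_add X,
     smult = (\<lambda>a C. \<Union>x\<in>C. N +>\<^bsub>X\<^esub> (a \<odot>\<^bsub>X\<^esub> x))\<rparr>"


section \<open>Functors from \<open>A\<close>-modules to \<open>A\<close>-modules\<close>

text \<open>The source category consists of the modules with elements in a type \<^typ>\<open>'u\<close>.
  The action on a morphism \<open>f\<close> with domain \<open>U\<close> is \<open>Fm U f\<close>.\<close>

definition module_functor ::
  "('a, 'k) ring_scheme \<Rightarrow> (('a, 'u) module \<Rightarrow> ('a, 'w) module)
    \<Rightarrow> (('a, 'u) module \<Rightarrow> ('u \<Rightarrow> 'u) \<Rightarrow> ('w \<Rightarrow> 'w)) \<Rightarrow> bool"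
  where "module_functor A F Fm \<longleftrightarrow>
    (\<forall>U. module A U \<longrightarrow> module A (F U)) \<and>
    (\<forall>U V f. module A U \<longrightarrow> module A V \<longrightarrow> f \<in> mod_hom A U V \<longrightarrow> Fm U f \<in> mod_hom A (F U) (F V)) \<and>
    (\<forall>U. module A U \<longrightarrow> Fm U (\<lambda>x\<in>carrier U. x) = (\<lambda>x\<in>carrier (F U). x)) \<and>
    (\<forall>U V (W :: ('a, 'u) module) f g. module A U \<longrightarrow> module A V \<longrightarrow> module A W \<longrightarrow>
      f \<in> mod_hom A U V \<longrightarrow> g \<in> mod_hom A V W \<longrightarrow>
      Fm U (compose (carrier U) g f) = compose (carrier (F U)) (Fm V g) (Fm U f))"

definition natural_iso ::
  "('a, 'k) ring_scheme
    \<Rightarrow> (('a, 'u) module \<Rightarrow> ('a, 'v) module) \<Rightarrow> (('a, 'u) module \<Rightarrow> ('u \<Rightarrow> 'u) \<Rightarrow> ('v \<Rightarrow> 'v))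
    \<Rightarrow> (('a, 'u) module \<Rightarrow> ('a, 'w) module) \<Rightarrow> (('a, 'u) module \<Rightarrow> ('u \<Rightarrow> 'u) \<Rightarrow> ('w \<Rightarrow> 'w))
    \<Rightarrow> (('a, 'u) module \<Rightarrow> 'v \<Rightarrow> 'w) \<Rightarrow> bool"
  where "natural_iso A F Fm G Gm \<eta> \<longleftrightarrow>
    (\<forall>U. module A U \<longrightarrow> \<eta> U \<in> mod_iso A (F U) (G U)) \<and>
    (\<forall>U V f. module A U \<longrightarrow> module A V \<longrightarrow> f \<in> mod_hom A U V \<longrightarrow>
      compose (carrier (F U)) (\<eta> V) (Fm U f) = compose (carrier (F U)) (Gm U f) (\<eta> U))"

definition represents ::
  "('a, 'k) ring_scheme \<Rightarrow> ('a, 'b) module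
    \<Rightarrow> (('a, 'u) module \<Rightarrow> ('a, 'w) module) \<Rightarrow> (('a, 'u) module \<Rightarrow> ('u \<Rightarrow> 'u) \<Rightarrow> ('w \<Rightarrow> 'w)) \<Rightarrow> bool"
  where "represents A M F Fm \<longleftrightarrow>
    module A M \<and> module_functor A F Fm \<and>
    module_functor A (Hom_module A M :: ('a, 'u) module \<Rightarrow> _) (Hom_map A M) \<and>
    (\<exists>\<eta>. natural_iso A (Hom_module A M) (Hom_map A M) F Fm \<eta>)"


section \<open>\<open>\<alpha>\<close>-derivations and differential modules\<close>

definition derivations ::
  "('a, 'k) ring_scheme \<Rightarrow> ('r, 'l) monoid_scheme \<Rightarrow> ('r \<Rightarrow> 'a) \<Rightarrow> ('a, 'u, 'm) module_scheme
    \<Rightarrow> ('a \<Rightarrow> 'u) set"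
  where "derivations A R \<alpha> U =
    {D \<in> carrier A \<rightarrow>\<^sub>E carrier U.
      (\<forall>r\<in>carrier R. D (\<alpha> r) = \<zero>\<^bsub>U\<^esub>) \<and>
      (\<forall>a\<in>carrier A. \<forall>b\<in>carrier A. D (a \<otimes>\<^bsub>A\<^esub> b) = a \<odot>\<^bsub>U\<^esub> D b \<oplus>\<^bsub>U\<^esub> b \<odot>\<^bsub>U\<^esub> D a)}"

definition Der ::
  "('a, 'k) ring_scheme \<Rightarrow> ('r, 'l) monoid_scheme \<Rightarrow> ('r \<Rightarrow> 'a) \<Rightarrow> ('a, 'u, 'm) module_scheme
    \<Rightarrow> ('a, 'a \<Rightarrow> 'u) module"
  where "Der A R \<alpha> U = pointwise_module (carrier A) U (derivations A R \<alpha> U)"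

definition Der_map ::
  "('a, 'k) ring_scheme \<Rightarrow> ('r, 'l) monoid_scheme \<Rightarrow> ('r \<Rightarrow> 'a) \<Rightarrow> ('a, 'u, 'm) module_scheme
    \<Rightarrow> ('u \<Rightarrow> 'v) \<Rightarrow> ('a \<Rightarrow> 'u) \<Rightarrow> ('a \<Rightarrow> 'v)"
  where "Der_map A R \<alpha> U f = (\<lambda>D\<in>carrier (Der A R \<alpha> U). compose (carrier A) f D)"

definition differential_module ::
  "('a, 'k) ring_scheme \<Rightarrow> ('r, 'l) monoid_scheme \<Rightarrow> ('r \<Rightarrow> 'a)
    \<Rightarrow> ('a, 'u) module \<times> ('a \<Rightarrow> 'u) \<Rightarrow> bool"
  where "differential_module A R \<alpha> = (\<lambda>(U, D). module A U \<and> D \<in> carrier (Der A R \<alpha> U))"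

definition differential_hom ::
  "('a, 'k) ring_scheme \<Rightarrow> ('a, 'u) module \<times> ('a \<Rightarrow> 'u) \<Rightarrow> ('a, 'v) module \<times> ('a \<Rightarrow> 'v)
    \<Rightarrow> ('u \<Rightarrow> 'v) set"
  where "differential_hom A =
    (\<lambda>(U, D) (V, E). {f \<in> mod_hom A U V. E = compose (carrier A) f D})"

text \<open>HOL cannot quantify over types inside a formula, so the type \<^typ>\<open>'v\<close> of elements of the
  test objects is a parameter.  Initiality means that this holds for every \<^typ>\<open>'v\<close>.\<close>

definition initial_differential_module ::
  "'v itself \<Rightarrow> ('a, 'k) ring_scheme \<Rightarrow> ('r, 'l) monoid_scheme \<Rightarrow> ('r \<Rightarrow> 'a)
    \<Rightarrow> ('a, 'u) module \<times> ('a \<Rightarrow> 'u) \<Rightarrow> bool"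
  where "initial_differential_module _ A R \<alpha> P \<longleftrightarrow>
    differential_module A R \<alpha> P \<and>
    (\<forall>Q :: ('a, 'v) module \<times> ('a \<Rightarrow> 'v).
      differential_module A R \<alpha> Q \<longrightarrow> (\<exists>!f. f \<in> differential_hom A P Q))"


section \<open>The module of differentials\<close>

definition free_module :: "('a, 'k) ring_scheme \<Rightarrow> ('a, 'a \<Rightarrow> 'a) module"
  where "free_module A =
    \<lparr>carrier = {x \<in> carrier A \<rightarrow>\<^sub>E carrier A. finite {a \<in> carrier A. x a \<noteq> \<zero>\<^bsub>A\<^esub>}},
     mult = undefined, one = undefined,
     zero = (\<lambda>c\<in>carrier A. \<zero>\<^bsub>A\<^esub>), add = (\<lambda>x y. \<lambda>c\<in>carrier A. x c \<oplus>\<^bsub>A\<^esub> y c),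
     smult = (\<lambda>a x. \<lambda>c\<in>carrier A. a \<otimes>\<^bsub>A\<^esub> x c)\<rparr>"

definition free_gen :: "('a, 'k) ring_scheme \<Rightarrow> 'a \<Rightarrow> ('a \<Rightarrow> 'a)"
  where "free_gen A a = (\<lambda>c\<in>carrier A. if c = a then \<one>\<^bsub>A\<^esub> else \<zero>\<^bsub>A\<^esub>)"

definition relations ::
  "('a, 'k) ring_scheme \<Rightarrow> ('r, 'l) monoid_scheme \<Rightarrow> ('r \<Rightarrow> 'a) \<Rightarrow> ('a \<Rightarrow> 'a) set"
  where "relations A R \<alpha> =
    (let X = free_module A; e = free_gen A in
      (\<lambda>N. submodule N A X) hull
        ({e (\<alpha> r) | r. r \<in> carrier R} \<union>
         {e (a \<otimes>\<^bsub>A\<^esub> b) \<ominus>\<^bsub>X\<^esub> a \<odot>\<^bsub>X\<^esub> e b \<ominus>\<^bsub>X\<^esub> b \<odot>\<^bsub>X\<^esub> e a | a b. a \<in> carrier A \<and> b \<in> carrier A}))"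

definition Omega ::
  "('a, 'k) ring_scheme \<Rightarrow> ('r, 'l) monoid_scheme \<Rightarrow> ('r \<Rightarrow> 'a) \<Rightarrow> ('a, ('a \<Rightarrow> 'a) set) module"
  where "Omega A R \<alpha> = quotient_module (free_module A) (relations A R \<alpha>)"

definition univ_der ::
  "('a, 'k) ring_scheme \<Rightarrow> ('r, 'l) monoid_scheme \<Rightarrow> ('r \<Rightarrow> 'a) \<Rightarrow> 'a \<Rightarrow> ('a \<Rightarrow> 'a) set"
  where "univ_der A R \<alpha> = (\<lambda>a\<in>carrier A. relations A R \<alpha> +>\<^bsub>free_module A\<^esub> free_gen A a)"

definition eta ::
  "('a, 'k) ring_scheme \<Rightarrow> ('r, 'l) monoid_scheme \<Rightarrow> ('r \<Rightarrow> 'a) \<Rightarrow> ('a, 'u, 'm) module_scheme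
    \<Rightarrow> (('a \<Rightarrow> 'a) set \<Rightarrow> 'u) \<Rightarrow> ('a \<Rightarrow> 'u)"
  where "eta A R \<alpha> U =
    (\<lambda>\<psi>\<in>carrier (Hom_module A (Omega A R \<alpha>) U). compose (carrier A) \<psi> (univ_der A R \<alpha>))"

end

theory Submission
  imports Defs
begin

text \<open>
  An \<open>A\<close>-linear map on the free module on \<open>A\<close> is the same thing as an arbitrary function
  \<open>D\<close> on \<open>A\<close>, via \<open>D a = f (e a)\<close>; the generators of the relation submodule lie in the kernel
  of \<open>f\<close> exactly when \<open>D\<close> is a derivation.  Applied to the projection onto \<open>\<Omega>\<close> this shows that
  the universal map is a derivation, and applied to the free extension of a derivation it yields
  the factorization through \<open>\<Omega>\<close>.
\<close>


section \<open>Module homomorphisms\<close>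

text \<open>Derivations need not be additive, so \<Omega> has one generator for each element of
  \<open>A\<close> and no relation between \<open>e_(a+b)\<close> and \<open>e_a + e_b\<close>.
  Uniqueness of the factorization combines two facts: a submodule containing all generators is the
  whole free module, and the projection onto \<Omega> is surjective. Passing from the generating
  relations to the submodule they generate is possible because the kernel of a linear map is itself
  a submodule. Hom and Der are both sets of extensional functions with pointwise operations; their
  module axioms and functor laws are therefore reduced to general facts about such sets, and
  \<open>eta\<close> is linear because precomposition with a fixed map respects pointwise
  operations.\<close>

lemma mod_homI:
  assumes "f \<in> carrier M \<rightarrow>\<^sub>E carrier N"
    and "\<And>x y. x \<in> carrier M \<Longrightarrow> y \<in> carrier M \<Longrightarrow> f (x \<oplus>\<^bsub>M\<^esub> y) = f x \<oplus>\<^bsub>N\<^esub> f y"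
    and "\<And>a x. a \<in> carrier A \<Longrightarrow> x \<in> carrier M \<Longrightarrow> f (a \<odot>\<^bsub>M\<^esub> x) = a \<odot>\<^bsub>N\<^esub> f x"
  shows "f \<in> mod_hom A M N"
  using assms by (simp add: mod_hom_def)

lemma mod_hom_PiE: "f \<in> mod_hom A M N \<Longrightarrow> f \<in> carrier M \<rightarrow>\<^sub>E carrier N"
  by (simp add: mod_hom_def)

lemma mod_hom_closed: "f \<in> mod_hom A M N \<Longrightarrow> x \<in> carrier M \<Longrightarrow> f x \<in> carrier N"
  by (auto simp: mod_hom_def)

lemma mod_hom_add:
  "f \<in> mod_hom A M N \<Longrightarrow> x \<in> carrier M \<Longrightarrow> y \<in> carrier M \<Longrightarrow> f (x \<oplus>\<^bsub>M\<^esub> y) = f x \<oplus>\<^bsub>N\<^esub> f y"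
  by (simp add: mod_hom_def)

lemma mod_hom_smult:
  "f \<in> mod_hom A M N \<Longrightarrow> a \<in> carrier A \<Longrightarrow> x \<in> carrier M \<Longrightarrow> f (a \<odot>\<^bsub>M\<^esub> x) = a \<odot>\<^bsub>N\<^esub> f x"
  by (simp add: mod_hom_def)

text \<open>\<open>mod_hom\<close> only demands compatibility with sums and scalars. Zero is
  recovered from the scalar 0, and negatives in \<open>mod_hom_a_inv\<close> from the scalar
  -1.\<close>

lemma mod_hom_zero:
  assumes M: "module A M" and N: "module A N" and f: "f \<in> mod_hom A M N"
  shows "f \<zero>\<^bsub>M\<^esub> = \<zero>\<^bsub>N\<^esub>"
proof -
  interpret M: module A M by (rule M)
  interpret N: module A N by (rule N)
  have "f \<zero>\<^bsub>M\<^esub> = f (\<zero>\<^bsub>A\<^esub> \<odot>\<^bsub>M\<^esub> \<zero>\<^bsub>M\<^esub>)" by simp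
  also have "\<dots> = \<zero>\<^bsub>A\<^esub> \<odot>\<^bsub>N\<^esub> f \<zero>\<^bsub>M\<^esub>" by (rule mod_hom_smult[OF f]) simp_all
  also have "\<dots> = \<zero>\<^bsub>N\<^esub>" using mod_hom_closed[OF f] by simp
  finally show ?thesis .
qed

lemma mod_hom_a_inv:
  assumes M: "module A M" and N: "module A N" and f: "f \<in> mod_hom A M N" and x: "x \<in> carrier M"
  shows "f (\<ominus>\<^bsub>M\<^esub> x) = \<ominus>\<^bsub>N\<^esub> f x"
proof -
  interpret M: module A M by (rule M)
  interpret N: module A N by (rule N)
  have "f (\<ominus>\<^bsub>M\<^esub> x) = f ((\<ominus>\<^bsub>A\<^esub> \<one>\<^bsub>A\<^esub>) \<odot>\<^bsub>M\<^esub> x)" using x by (simp add: M.smult_l_minus)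
  also have "\<dots> = (\<ominus>\<^bsub>A\<^esub> \<one>\<^bsub>A\<^esub>) \<odot>\<^bsub>N\<^esub> f x" by (rule mod_hom_smult[OF f]) (simp_all add: x)
  also have "\<dots> = \<ominus>\<^bsub>N\<^esub> f x" using mod_hom_closed[OF f x] by (simp add: N.smult_l_minus)
  finally show ?thesis .
qed

lemma mod_hom_minus:
  assumes M: "module A M" and N: "module A N" and f: "f \<in> mod_hom A M N"
    and x: "x \<in> carrier M" and y: "y \<in> carrier M"
  shows "f (x \<ominus>\<^bsub>M\<^esub> y) = f x \<ominus>\<^bsub>N\<^esub> f y"
proof -
  interpret M: module A M by (rule M)
  show ?thesis
    using x y by (simp add: a_minus_def mod_hom_add[OF f] mod_hom_a_inv[OF M N f])
qed

lemma mod_hom_compose: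
  assumes f: "f \<in> mod_hom A L M" and g: "g \<in> mod_hom A M N" and L: "module A L"
  shows "compose (carrier L) g f \<in> mod_hom A L N"
proof -
  interpret L: module A L by (rule L)
  show ?thesis
    by (rule mod_homI)
      (auto simp: compose_eq mod_hom_closed[OF f] mod_hom_closed[OF g] mod_hom_add[OF f]
        mod_hom_add[OF g] mod_hom_smult[OF f] mod_hom_smult[OF g] compose_def)
qed

text \<open>Every element of \<open>Q\<close> has the form \<open>p x\<close>, so each axiom of
  \<open>Q\<close> is the image under \<open>p\<close> of the same axiom of \<open>X\<close>. This
  avoids checking the module axioms on cosets directly.\<close>

lemma module_surj_image:
  assumes X: "module A X" and surj: "p ` carrier X = carrier Q"
    and add: "\<And>x y. x \<in> carrier X \<Longrightarrow> y \<in> carrier X \<Longrightarrow> p (x \<oplus>\<^bsub>X\<^esub> y) = p x \<oplus>\<^bsub>Q\<^esub> p y"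
    and smult: "\<And>a x. a \<in> carrier A \<Longrightarrow> x \<in> carrier X \<Longrightarrow> p (a \<odot>\<^bsub>X\<^esub> x) = a \<odot>\<^bsub>Q\<^esub> p x"
    and zero: "p \<zero>\<^bsub>X\<^esub> = \<zero>\<^bsub>Q\<^esub>"
  shows "module A Q"
proof -
  interpret X: module A X by (rule X)
  have rep: "\<exists>x\<in>carrier X. u = p x" if "u \<in> carrier Q" for u
    using that surj by blast
  have cl: "p x \<in> carrier Q" if "x \<in> carrier X" for x
    using that surj by blast
  note rules = add[symmetric] smult[symmetric] zero[symmetric] cl
  show ?thesis
  proof (intro moduleI abelian_groupI)
    fix u assume "u \<in> carrier Q"
    then obtain x where x: "x \<in> carrier X" "u = p x" using rep by blast
    show "\<exists>v\<in>carrier Q. v \<oplus>\<^bsub>Q\<^esub> u = \<zero>\<^bsub>Q\<^esub>"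
      by (rule bexI[of _ "p (\<ominus>\<^bsub>X\<^esub> x)"]) (simp_all add: x rules X.M.l_neg)
  qed (use X.cring_axioms in \<open>auto dest!: rep simp: rules X.M.a_ac X.smult_l_distr X.smult_r_distr X.smult_assoc1\<close>)
qed

text \<open>Serves uniqueness: once the equalizer contains a generating set, the two maps
  coincide.\<close>

lemma (in module) submodule_equalizer:
  assumes U: "module R U" and f: "f \<in> mod_hom R M U" and g: "g \<in> mod_hom R M U"
  shows "submodule {x \<in> carrier M. f x = g x} R M"
proof -
  note M = module_axioms
  show ?thesis
    by (rule submoduleI)
      (auto simp: mod_hom_zero[OF M U f] mod_hom_zero[OF M U g] mod_hom_add[OF f] mod_hom_add[OF g]
        mod_hom_smult[OF f] mod_hom_smult[OF g] mod_hom_a_inv[OF M U f] mod_hom_a_inv[OF M U g])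
qed

text \<open>Serves existence: a map that vanishes on generators of a submodule vanishes on all of
  it.\<close>

lemma (in module) submodule_kernel:
  assumes U: "module R U" and f: "f \<in> mod_hom R M U"
  shows "submodule {x \<in> carrier M. f x = \<zero>\<^bsub>U\<^esub>} R M"
proof -
  interpret U: module R U by (rule U)
  note M = module_axioms
  show ?thesis
    by (rule submoduleI)
      (auto simp: mod_hom_zero[OF M U f] mod_hom_add[OF f] mod_hom_smult[OF f] mod_hom_a_inv[OF M U f])
qed

text \<open>An empty family would intersect to the whole type, which need not lie in the carrier;
  hence the nonemptiness condition.\<close>

lemma (in module) submodule_Inter:
  assumes "\<And>N. N \<in> \<N> \<Longrightarrow> submodule N R M" and "\<N> \<noteq> {}"
  shows "submodule (\<Inter>\<N>) R M"
proof (rule submoduleI)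
  note N = submoduleE[OF assms(1)]
  show "\<Inter>\<N> \<subseteq> carrier M" using N(1) assms(2) by blast
  show "\<zero>\<^bsub>M\<^esub> \<in> \<Inter>\<N>"
    using subgroup.one_closed[OF submodule.axioms(1)[OF assms(1)]] by simp
  show "\<ominus>\<^bsub>M\<^esub> x \<in> \<Inter>\<N>" if "x \<in> \<Inter>\<N>" for x
    using N(3) that by simp
  show "x \<oplus>\<^bsub>M\<^esub> y \<in> \<Inter>\<N>" if "x \<in> \<Inter>\<N>" "y \<in> \<Inter>\<N>" for x y
    using N(5) that by simp
  show "a \<odot>\<^bsub>M\<^esub> x \<in> \<Inter>\<N>" if "a \<in> carrier R" "x \<in> \<Inter>\<N>" for a x
    using N(4) that by simp
qed

lemma (in module) submodule_hull:
  assumes "S \<subseteq> carrier M"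
  shows "submodule ((\<lambda>N. submodule N R M) hull S) R M"
  \<comment> \<open>The family being intersected is nonempty because the carrier is itself a
    submodule containing \<open>S\<close>.\<close>
  unfolding hull_def by (rule submodule_Inter) (use assms carrier_is_submodule in auto)


section \<open>Modules of functions\<close>

lemma pointwise_module_simps [simp]:
  "carrier (pointwise_module S U F) = F"
  "zero (pointwise_module S U F) = (\<lambda>x\<in>S. \<zero>\<^bsub>U\<^esub>)"
  "f \<oplus>\<^bsub>pointwise_module S U F\<^esub> g = (\<lambda>x\<in>S. f x \<oplus>\<^bsub>U\<^esub> g x)"
  "a \<odot>\<^bsub>pointwise_module S U F\<^esub> f = (\<lambda>x\<in>S. a \<odot>\<^bsub>U\<^esub> f x)"
  by (simp_all add: pointwise_module_def)

text \<open>Common source of the module structures on Hom, on Der and on the free module. Each axiom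
  holds value by value in \<open>U\<close>, so only closure of \<open>F\<close> has to be
  supplied.\<close>

lemma module_pointwise:
  assumes U: "module A U" and F: "F \<subseteq> S \<rightarrow>\<^sub>E carrier U"
    and zero: "(\<lambda>x\<in>S. \<zero>\<^bsub>U\<^esub>) \<in> F"
    and add: "\<And>f g. f \<in> F \<Longrightarrow> g \<in> F \<Longrightarrow> (\<lambda>x\<in>S. f x \<oplus>\<^bsub>U\<^esub> g x) \<in> F"
    and smult: "\<And>a f. a \<in> carrier A \<Longrightarrow> f \<in> F \<Longrightarrow> (\<lambda>x\<in>S. a \<odot>\<^bsub>U\<^esub> f x) \<in> F"
  shows "module A (pointwise_module S U F)"
proof -
  interpret U: module A U by (rule U)
  have cl [simp]: "f x \<in> carrier U" if "f \<in> F" "x \<in> S" for f x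
    using that F by auto
  have ext: "f \<in> extensional S" if "f \<in> F" for f
    using that F by (auto simp: PiE_def)
  show ?thesis
  proof (intro moduleI abelian_groupI)
    fix f assume f: "f \<in> carrier (pointwise_module S U F)"
    show "\<exists>g\<in>carrier (pointwise_module S U F).
        g \<oplus>\<^bsub>pointwise_module S U F\<^esub> f = \<zero>\<^bsub>pointwise_module S U F\<^esub>"
      \<comment> \<open>The additive inverse is the multiple by the scalar -1, so closure under
        scalars also yields closure under negation.\<close>
      by (rule bexI[of _ "\<lambda>x\<in>S. (\<ominus>\<^bsub>A\<^esub> \<one>\<^bsub>A\<^esub>) \<odot>\<^bsub>U\<^esub> f x"])
        (use f in \<open>auto simp: U.smult_l_minus U.M.l_neg fun_eq_iff intro!: smult\<close>)
  next
    fix f assume f: "f \<in> carrier (pointwise_module S U F)"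
    \<comment> \<open>Restricting to \<open>S\<close> gives back \<open>f\<close> itself only
      because \<open>f\<close> is extensional on \<open>S\<close>.\<close>
    have "(\<lambda>x\<in>S. \<zero>\<^bsub>U\<^esub> \<oplus>\<^bsub>U\<^esub> f x) = f" "(\<lambda>x\<in>S. \<one>\<^bsub>A\<^esub> \<odot>\<^bsub>U\<^esub> f x) = f"
      by (rule extensionalityI[OF restrict_extensional ext]; use f in simp)+
    then show "\<zero>\<^bsub>pointwise_module S U F\<^esub> \<oplus>\<^bsub>pointwise_module S U F\<^esub> f = f"
      "\<one>\<^bsub>A\<^esub> \<odot>\<^bsub>pointwise_module S U F\<^esub> f = f"
      by (simp_all cong: restrict_cong)
  qed (simp_all add: U.cring_axioms zero add smult U.M.a_ac U.smult_l_distr U.smult_r_distr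
      U.smult_assoc1 cong: restrict_cong)
qed

text \<open>The action of both functors on a morphism; here linearity in \<phi> comes from linearity
  of \<open>f\<close>.\<close>

lemma postcompose_mod_hom:
  assumes f: "f \<in> mod_hom A U V" and F: "F \<subseteq> S \<rightarrow>\<^sub>E carrier U"
    and FG: "\<And>\<phi>. \<phi> \<in> F \<Longrightarrow> compose S f \<phi> \<in> G" and M: "module A (pointwise_module S U F)"
  shows "(\<lambda>\<phi>\<in>F. compose S f \<phi>) \<in> mod_hom A (pointwise_module S U F) (pointwise_module S V G)"
proof (rule mod_homI)
  interpret M: module A "pointwise_module S U F" by (rule M)
  have cl: "\<phi> x \<in> carrier U" if "\<phi> \<in> F" "x \<in> S" for \<phi> x
    using that F by auto
  fix \<phi> \<psi> assume "\<phi> \<in> carrier (pointwise_module S U F)" "\<psi> \<in> carrier (pointwise_module S U F)"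
  with M.M.a_closed[OF this]
  show "(\<lambda>\<phi>\<in>F. compose S f \<phi>) (\<phi> \<oplus>\<^bsub>pointwise_module S U F\<^esub> \<psi>)
    = (\<lambda>\<phi>\<in>F. compose S f \<phi>) \<phi> \<oplus>\<^bsub>pointwise_module S V G\<^esub> (\<lambda>\<phi>\<in>F. compose S f \<phi>) \<psi>"
    by (simp add: compose_def cl mod_hom_add[OF f] cong: restrict_cong)
next
  interpret M: module A "pointwise_module S U F" by (rule M)
  have cl: "\<phi> x \<in> carrier U" if "\<phi> \<in> F" "x \<in> S" for \<phi> x
    using that F by auto
  fix a \<phi> assume "a \<in> carrier A" "\<phi> \<in> carrier (pointwise_module S U F)"
  with M.smult_closed[OF this]
  show "(\<lambda>\<phi>\<in>F. compose S f \<phi>) (a \<odot>\<^bsub>pointwise_module S U F\<^esub> \<phi>)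
    = a \<odot>\<^bsub>pointwise_module S V G\<^esub> (\<lambda>\<phi>\<in>F. compose S f \<phi>) \<phi>"
    by (simp add: compose_def cl mod_hom_smult[OF f] cong: restrict_cong)
qed (simp add: FG)

text \<open>Sums and multiples are formed at each argument, so \<open>d\<close> may be any map into
  \<open>S\<close>. This matters for \<open>eta\<close>, where \<open>d\<close> is the universal
  derivation and is not linear.\<close>

lemma precompose_mod_hom:
  assumes d: "d \<in> T \<rightarrow> S" and FG: "\<And>\<phi>. \<phi> \<in> F \<Longrightarrow> compose T \<phi> d \<in> G"
    and M: "module A (pointwise_module S U F)"
  shows "(\<lambda>\<phi>\<in>F. compose T \<phi> d) \<in> mod_hom A (pointwise_module S U F) (pointwise_module T U G)"
proof (rule mod_homI)
  interpret M: module A "pointwise_module S U F" by (rule M)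
  fix \<phi> \<psi> assume "\<phi> \<in> carrier (pointwise_module S U F)" "\<psi> \<in> carrier (pointwise_module S U F)"
  with M.M.a_closed[OF this] d
  show "(\<lambda>\<phi>\<in>F. compose T \<phi> d) (\<phi> \<oplus>\<^bsub>pointwise_module S U F\<^esub> \<psi>)
    = (\<lambda>\<phi>\<in>F. compose T \<phi> d) \<phi> \<oplus>\<^bsub>pointwise_module T U G\<^esub> (\<lambda>\<phi>\<in>F. compose T \<phi> d) \<psi>"
    by (simp add: compose_def Pi_iff cong: restrict_cong)
next
  interpret M: module A "pointwise_module S U F" by (rule M)
  fix a \<phi> assume "a \<in> carrier A" "\<phi> \<in> carrier (pointwise_module S U F)"
  with M.smult_closed[OF this] d
  show "(\<lambda>\<phi>\<in>F. compose T \<phi> d) (a \<odot>\<^bsub>pointwise_module S U F\<^esub> \<phi>)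
    = a \<odot>\<^bsub>pointwise_module T U G\<^esub> (\<lambda>\<phi>\<in>F. compose T \<phi> d) \<phi>"
    by (simp add: compose_def Pi_iff cong: restrict_cong)
qed (simp add: FG)

text \<open>The functor laws reduce to the unit and associativity laws for composition of
  extensional functions, so Hom and Der can share this argument.\<close>

lemma module_functor_pointwise:
  fixes F :: "('a, 'u) module \<Rightarrow> ('x \<Rightarrow> 'u) set"
  assumes F: "\<And>U. F U \<subseteq> S \<rightarrow>\<^sub>E carrier U"
    and M: "\<And>U. module A U \<Longrightarrow> module A (pointwise_module S U (F U))"
    and FF: "\<And>U V f \<phi>. module A U \<Longrightarrow> module A V \<Longrightarrow> f \<in> mod_hom A U V \<Longrightarrow> \<phi> \<in> F U
      \<Longrightarrow> compose S f \<phi> \<in> F V"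
  shows "module_functor A (\<lambda>U. pointwise_module S U (F U)) (\<lambda>U f. \<lambda>\<phi>\<in>F U. compose S f \<phi>)"
  unfolding module_functor_def
proof (intro conjI allI impI)
  fix U V :: "('a, 'u) module" and f
  assume "module A U" "module A V" "f \<in> mod_hom A U V"
  then show "(\<lambda>\<phi>\<in>F U. compose S f \<phi>)
      \<in> mod_hom A (pointwise_module S U (F U)) (pointwise_module S V (F V))"
    by (intro postcompose_mod_hom F M) (auto intro: FF)
next
  fix U :: "('a, 'u) module"
  have "compose S (\<lambda>x\<in>carrier U. x) \<phi> = \<phi>" if "\<phi> \<in> F U" for \<phi>
    using that F[of U] by (intro Id_compose) (auto simp: PiE_def)
  then show "(\<lambda>\<phi>\<in>F U. compose S (\<lambda>x\<in>carrier U. x) \<phi>)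
      = (\<lambda>\<phi>\<in>carrier (pointwise_module S U (F U)). \<phi>)"
    by (simp cong: restrict_cong)
next
  fix U V W :: "('a, 'u) module" and f g :: "'u \<Rightarrow> 'u"
  assume U: "module A U" "module A V" "f \<in> mod_hom A U V"
  have "compose S (compose (carrier U) g f) \<phi> = compose S g (compose S f \<phi>)" if "\<phi> \<in> F U" for \<phi>
    using that F[of U] by (intro compose_assoc[symmetric]) auto
  then show "(\<lambda>\<phi>\<in>F U. compose S (compose (carrier U) g f) \<phi>)
    = compose (carrier (pointwise_module S U (F U))) (\<lambda>\<phi>\<in>F V. compose S g \<phi>)
        (\<lambda>\<phi>\<in>F U. compose S f \<phi>)"
    using FF[OF U] by (auto simp: compose_def[of "F U"] fun_eq_iff)
qed (use M in auto)

section \<open>The module of linear maps and the covariant Hom functor\<close>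

lemma mod_hom_subset: "mod_hom A M U \<subseteq> carrier M \<rightarrow>\<^sub>E carrier U"
  by (auto simp: mod_hom_def)

lemma carrier_Hom_module [simp]: "carrier (Hom_module A M U) = mod_hom A M U"
  by (simp add: Hom_module_def)

lemma module_Hom:
  assumes M: "module A M" and U: "module A U"
  shows "module A (Hom_module A M U)"
proof -
  interpret M: module A M by (rule M)
  interpret U: module A U by (rule U)
  show ?thesis
    unfolding Hom_module_def
  proof (rule module_pointwise[OF U mod_hom_subset])
    fix f g assume fg: "f \<in> mod_hom A M U" "g \<in> mod_hom A M U"
    show "(\<lambda>x\<in>carrier M. f x \<oplus>\<^bsub>U\<^esub> g x) \<in> mod_hom A M U"
      by (rule mod_homI) (use fg in \<open>auto simp: mod_hom_closed mod_hom_add mod_hom_smult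
            U.M.a_ac U.smult_r_distr\<close>)
  next
    fix a f assume a: "a \<in> carrier A" and f: "f \<in> mod_hom A M U"
    \<comment> \<open>Commutativity of \<open>A\<close> is what makes a scalar multiple of a linear
      map linear.\<close>
    have "a \<odot>\<^bsub>U\<^esub> (b \<odot>\<^bsub>U\<^esub> u) = b \<odot>\<^bsub>U\<^esub> (a \<odot>\<^bsub>U\<^esub> u)" if "b \<in> carrier A" "u \<in> carrier U" for b u
      using that a by (simp add: U.smult_assoc1[symmetric] M.R.m_comm)
    then show "(\<lambda>x\<in>carrier M. a \<odot>\<^bsub>U\<^esub> f x) \<in> mod_hom A M U"
      by (intro mod_homI) (use a f in \<open>auto simp: mod_hom_closed mod_hom_add mod_hom_smult
            U.smult_r_distr\<close>)
  qed (rule mod_homI; auto)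
qed

lemma module_functor_Hom:
  fixes A :: "('a, 'k) ring_scheme"
  assumes M: "module A M"
  shows "module_functor A (Hom_module A M :: ('a, 'u) module \<Rightarrow> _) (Hom_map A M)"
proof -
  have "module_functor A (\<lambda>U :: ('a, 'u) module. pointwise_module (carrier M) U (mod_hom A M U))
      (\<lambda>U f. \<lambda>\<phi>\<in>mod_hom A M U. compose (carrier M) f \<phi>)"
    using module_Hom[OF M] mod_hom_compose M
    by (intro module_functor_pointwise) (auto simp: Hom_module_def mod_hom_subset mod_hom_PiE)
  then show ?thesis
    by (simp add: Hom_module_def[abs_def] Hom_map_def[abs_def])
qed


section \<open>Derivations\<close>

lemma derivationsI:
  assumes "D \<in> carrier A \<rightarrow>\<^sub>E carrier U" and "\<And>r. r \<in> carrier R \<Longrightarrow> D (\<alpha> r) = \<zero>\<^bsub>U\<^esub>"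
    and "\<And>a b. a \<in> carrier A \<Longrightarrow> b \<in> carrier A
      \<Longrightarrow> D (a \<otimes>\<^bsub>A\<^esub> b) = a \<odot>\<^bsub>U\<^esub> D b \<oplus>\<^bsub>U\<^esub> b \<odot>\<^bsub>U\<^esub> D a"
  shows "D \<in> derivations A R \<alpha> U"
  using assms by (simp add: derivations_def)

lemma derivations_subset: "derivations A R \<alpha> U \<subseteq> carrier A \<rightarrow>\<^sub>E carrier U"
  by (auto simp: derivations_def)

lemma derivations_closed: "D \<in> derivations A R \<alpha> U \<Longrightarrow> a \<in> carrier A \<Longrightarrow> D a \<in> carrier U"
  using derivations_subset by blast

lemma derivations_base: "D \<in> derivations A R \<alpha> U \<Longrightarrow> r \<in> carrier R \<Longrightarrow> D (\<alpha> r) = \<zero>\<^bsub>U\<^esub>"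
  by (simp add: derivations_def)

lemma derivations_mult:
  "D \<in> derivations A R \<alpha> U \<Longrightarrow> a \<in> carrier A \<Longrightarrow> b \<in> carrier A
    \<Longrightarrow> D (a \<otimes>\<^bsub>A\<^esub> b) = a \<odot>\<^bsub>U\<^esub> D b \<oplus>\<^bsub>U\<^esub> b \<odot>\<^bsub>U\<^esub> D a"
  by (simp add: derivations_def)

lemma carrier_Der [simp]: "carrier (Der A R \<alpha> U) = derivations A R \<alpha> U"
  by (simp add: Der_def)

lemma module_Der:
  assumes U: "module A U" and \<alpha>: "\<alpha> \<in> carrier R \<rightarrow> carrier A"
  shows "module A (Der A R \<alpha> U)"
proof -
  interpret U: module A U by (rule U)
  have \<alpha>_closed [simp]: "\<alpha> r \<in> carrier A" if "r \<in> carrier R" for r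
    using that \<alpha> by auto
  show ?thesis
    unfolding Der_def
  proof (rule module_pointwise[OF U derivations_subset])
    fix D E assume D: "D \<in> derivations A R \<alpha> U" and E: "E \<in> derivations A R \<alpha> U"
    note rules = derivations_closed[OF D] derivations_base[OF D] derivations_mult[OF D]
      derivations_closed[OF E] derivations_base[OF E] derivations_mult[OF E]
    show "(\<lambda>x\<in>carrier A. D x \<oplus>\<^bsub>U\<^esub> E x) \<in> derivations A R \<alpha> U"
      by (rule derivationsI) (auto simp: rules U.M.a_ac U.smult_r_distr)
  next
    fix a D assume a: "a \<in> carrier A" and D: "D \<in> derivations A R \<alpha> U"
    \<comment> \<open>Commuting scalars allow \<open>a\<close> to be moved past the coefficients in
      both terms of the Leibniz rule.\<close>
    have "a \<odot>\<^bsub>U\<^esub> (b \<odot>\<^bsub>U\<^esub> u) = b \<odot>\<^bsub>U\<^esub> (a \<odot>\<^bsub>U\<^esub> u)" if "b \<in> carrier A" "u \<in> carrier U" for b u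
      using that a by (simp add: U.smult_assoc1[symmetric] U.R.m_comm)
    then show "(\<lambda>x\<in>carrier A. a \<odot>\<^bsub>U\<^esub> D x) \<in> derivations A R \<alpha> U"
      by (intro derivationsI) (use a in \<open>auto simp: derivations_closed[OF D] derivations_base[OF D]
            derivations_mult[OF D] U.smult_r_distr\<close>)
  qed (rule derivationsI; auto)
qed

text \<open>Gives the action of Der on morphisms and, applied to the universal derivation, shows
  that \<open>eta\<close> takes values in derivations.\<close>

lemma mod_hom_compose_derivation:
  assumes U: "module A U" and V: "module A V" and \<alpha>: "\<alpha> \<in> carrier R \<rightarrow> carrier A"
    and f: "f \<in> mod_hom A U V" and D: "D \<in> derivations A R \<alpha> U"
  shows "compose (carrier A) f D \<in> derivations A R \<alpha> V"
proof -
  interpret U: module A U by (rule U)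
  have "\<alpha> r \<in> carrier A" if "r \<in> carrier R" for r
    using that \<alpha> by auto
  then show ?thesis
    by (intro derivationsI)
      (auto simp: compose_def derivations_closed[OF D] derivations_base[OF D] derivations_mult[OF D]
        mod_hom_closed[OF f] mod_hom_add[OF f] mod_hom_smult[OF f] mod_hom_zero[OF U V f])
qed

lemma module_functor_Der:
  fixes A :: "('a, 'k) ring_scheme"
  assumes \<alpha>: "\<alpha> \<in> carrier R \<rightarrow> carrier A"
  shows "module_functor A (Der A R \<alpha> :: ('a, 'u) module \<Rightarrow> _) (Der_map A R \<alpha>)"
proof -
  have "module_functor A
      (\<lambda>U :: ('a, 'u) module. pointwise_module (carrier A) U (derivations A R \<alpha> U))
      (\<lambda>U f. \<lambda>\<phi>\<in>derivations A R \<alpha> U. compose (carrier A) f \<phi>)"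
    by (rule module_functor_pointwise[OF derivations_subset module_Der[OF _ \<alpha>, unfolded Der_def]
          mod_hom_compose_derivation[OF _ _ \<alpha>]])
  then show ?thesis
    by (simp add: Der_def[abs_def] Der_map_def[abs_def])
qed


section \<open>Quotient modules\<close>

context
  fixes A :: "('a, 'k) ring_scheme" and X :: "('a, 'b, 'm) module_scheme" and N :: "'b set"
  assumes X: "module A X" and N: "submodule N A X"
begin

interpretation X: module A X by (rule X)
interpretation N: abelian_subgroup N X
  by (rule abelian_subgroupI3)
    (use N in \<open>simp_all add: submodule_def additive_subgroup_def X.abelian_group_axioms\<close>)

lemma carrier_quotient_module: "carrier (quotient_module X N) = (\<lambda>x. N +>\<^bsub>X\<^esub> x) ` carrier X"
  by (auto simp: quotient_module_def A_RCOSETS_def' a_r_coset_def)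

lemma coset_eq_zero_iff:
  assumes "x \<in> carrier X"
  shows "N +>\<^bsub>X\<^esub> x = \<zero>\<^bsub>quotient_module X N\<^esub> \<longleftrightarrow> x \<in> N"
  using assms N.a_rcos_self N.a_rcos_const by (auto simp: quotient_module_def)

lemma coset_add:
  "x \<in> carrier X \<Longrightarrow> y \<in> carrier X
    \<Longrightarrow> N +>\<^bsub>X\<^esub> (x \<oplus>\<^bsub>X\<^esub> y) = (N +>\<^bsub>X\<^esub> x) \<oplus>\<^bsub>quotient_module X N\<^esub> (N +>\<^bsub>X\<^esub> y)"
  by (simp add: quotient_module_def N.a_rcos_sum)

text \<open>Membership in a coset is recast as a difference lying in \<open>N\<close>, the form to
  which scalars and linear maps can be applied.\<close>

lemma mem_cosetD:
  assumes "x \<in> carrier X" "y \<in> N +>\<^bsub>X\<^esub> x"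
  shows "y \<in> carrier X" "y \<ominus>\<^bsub>X\<^esub> x \<in> N"
  using assms N.a_elemrcos_carrier N.a_rcos_module_imp by (simp_all add: a_minus_def)

text \<open>The quotient's scalar multiplication is a union over all representatives, so this is its
  well-definedness: the cosets in the union all coincide, since \<open>a\<close> times an element of
  \<open>N\<close> stays in \<open>N\<close>.\<close>

lemma coset_smult:
  assumes a: "a \<in> carrier A" and x: "x \<in> carrier X"
  shows "N +>\<^bsub>X\<^esub> (a \<odot>\<^bsub>X\<^esub> x) = a \<odot>\<^bsub>quotient_module X N\<^esub> (N +>\<^bsub>X\<^esub> x)"
proof -
  have "N +>\<^bsub>X\<^esub> (a \<odot>\<^bsub>X\<^esub> y) = N +>\<^bsub>X\<^esub> (a \<odot>\<^bsub>X\<^esub> x)" if y: "y \<in> N +>\<^bsub>X\<^esub> x" for y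
  proof -
    note y = mem_cosetD[OF x y]
    have "a \<odot>\<^bsub>X\<^esub> (y \<ominus>\<^bsub>X\<^esub> x) \<in> N"
      by (rule X.submoduleE(4)[OF N a y(2)])
    then have "a \<odot>\<^bsub>X\<^esub> y \<oplus>\<^bsub>X\<^esub> \<ominus>\<^bsub>X\<^esub> (a \<odot>\<^bsub>X\<^esub> x) \<in> N"
      using a x y(1) by (simp add: a_minus_def X.smult_r_distr X.smult_r_minus)
    then have "a \<odot>\<^bsub>X\<^esub> y \<in> N +>\<^bsub>X\<^esub> (a \<odot>\<^bsub>X\<^esub> x)"
      using a x y(1) by (simp add: N.a_rcos_module)
    then show ?thesis
      using N.a_repr_independence'[of _ "a \<odot>\<^bsub>X\<^esub> x"] a x by simp
  qed
  then have "(\<Union>y\<in>N +>\<^bsub>X\<^esub> x. N +>\<^bsub>X\<^esub> (a \<odot>\<^bsub>X\<^esub> y))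
      = (\<Union>y\<in>N +>\<^bsub>X\<^esub> x. N +>\<^bsub>X\<^esub> (a \<odot>\<^bsub>X\<^esub> x))"
    by (rule SUP_cong[OF refl])
  \<comment> \<open>A constant union collapses to its member because the coset, containing
    \<open>x\<close>, is nonempty.\<close>
  also have "\<dots> = N +>\<^bsub>X\<^esub> (a \<odot>\<^bsub>X\<^esub> x)"
    using N.a_rcos_self[OF x] by blast
  finally show ?thesis by (simp add: quotient_module_def)
qed

lemma module_quotient: "module A (quotient_module X N)"
  by (rule module_surj_image[OF X carrier_quotient_module[symmetric] coset_add coset_smult])
    (simp_all add: coset_eq_zero_iff)

lemma coset_mod_hom: "(\<lambda>x\<in>carrier X. N +>\<^bsub>X\<^esub> x) \<in> mod_hom A X (quotient_module X N)"
  by (rule mod_homI) (auto simp: carrier_quotient_module coset_add coset_smult)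

lemma quotient_module_lift:
  assumes U: "module A U" and f: "f \<in> mod_hom A X U" and ker: "\<And>x. x \<in> N \<Longrightarrow> f x = \<zero>\<^bsub>U\<^esub>"
  obtains g where "g \<in> mod_hom A (quotient_module X N) U"
    "\<And>x. x \<in> carrier X \<Longrightarrow> g (N +>\<^bsub>X\<^esub> x) = f x"
proof
  interpret U: module A U by (rule U)
  \<comment> \<open>An arbitrary representative is chosen in each coset; two representatives differ
    by an element of \<open>N\<close>, which \<open>f\<close> sends to zero, so the choice does not
    affect the value.\<close>
  define g where "g = (\<lambda>C\<in>carrier (quotient_module X N). f (SOME x. x \<in> C))"
  show gf: "g (N +>\<^bsub>X\<^esub> x) = f x" if x: "x \<in> carrier X" for x
  proof -
    define y where "y = (SOME y. y \<in> N +>\<^bsub>X\<^esub> x)"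
    have "y \<in> N +>\<^bsub>X\<^esub> x"
      unfolding y_def by (rule someI, rule N.a_rcos_self[OF x])
    note y = mem_cosetD[OF x this]
    have "f y \<ominus>\<^bsub>U\<^esub> f x = \<zero>\<^bsub>U\<^esub>"
      using mod_hom_minus[OF X U f y(1) x] ker[OF y(2)] by simp
    then have "f y = f x"
      using mod_hom_closed[OF f] x y(1) by (simp add: U.M.add.inv_solve_right' a_minus_def)
    then show ?thesis using x by (simp add: g_def carrier_quotient_module y_def)
  qed
  show "g \<in> mod_hom A (quotient_module X N) U"
  proof (rule mod_homI)
    show "g \<in> carrier (quotient_module X N) \<rightarrow>\<^sub>E carrier U"
      using gf mod_hom_closed[OF f] by (auto simp: carrier_quotient_module g_def)
  qed (auto simp: carrier_quotient_module coset_add[symmetric] coset_smult[symmetric] gf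
      mod_hom_add[OF f] mod_hom_smult[OF f])
qed

end


section \<open>The free module\<close>

text \<open>\<open>A\<close> as a module over itself, introduced so that the free module becomes a
  set of functions with pointwise operations in a module.\<close>

definition regular_module :: "('a, 'k) ring_scheme \<Rightarrow> ('a, 'a) module"
  where "regular_module A = \<lparr>carrier = carrier A, mult = undefined, one = undefined,
    zero = \<zero>\<^bsub>A\<^esub>, add = add A, smult = mult A\<rparr>"

lemma regular_module_simps [simp]:
  "carrier (regular_module A) = carrier A" "zero (regular_module A) = \<zero>\<^bsub>A\<^esub>"
  "add (regular_module A) = add A" "smult (regular_module A) = mult A"
  by (simp_all add: regular_module_def)

lemma (in cring) module_regular: "module R (regular_module R)"
  by (intro moduleI abelian_groupI)
    (use cring_axioms add.inv_closed l_neg in \<open>auto simp: a_ac m_ac l_distr r_distr\<close>)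

text \<open>Makes \<open>module_pointwise\<close> applicable, leaving only closure of the finitely
  supported functions to check.\<close>

lemma free_module_eq:
  "free_module A = pointwise_module (carrier A) (regular_module A) (carrier (free_module A))"
  by (simp add: free_module_def pointwise_module_def)

lemma free_module_simps [simp]:
  "zero (free_module A) = (\<lambda>c\<in>carrier A. \<zero>\<^bsub>A\<^esub>)"
  "x \<oplus>\<^bsub>free_module A\<^esub> y = (\<lambda>c\<in>carrier A. x c \<oplus>\<^bsub>A\<^esub> y c)"
  "a \<odot>\<^bsub>free_module A\<^esub> x = (\<lambda>c\<in>carrier A. a \<otimes>\<^bsub>A\<^esub> x c)"
  by (simp_all add: free_module_def)

definition supp :: "('a, 'k) ring_scheme \<Rightarrow> ('a \<Rightarrow> 'a) \<Rightarrow> 'a set"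
  where "supp A x = {a \<in> carrier A. x a \<noteq> \<zero>\<^bsub>A\<^esub>}"

lemma carrier_free_module: "carrier (free_module A) = {x \<in> carrier A \<rightarrow>\<^sub>E carrier A. finite (supp A x)}"
  by (simp add: free_module_def supp_def)

lemma free_module_closed: "x \<in> carrier (free_module A) \<Longrightarrow> c \<in> carrier A \<Longrightarrow> x c \<in> carrier A"
  by (auto simp: carrier_free_module)

context cring
begin

lemma supp_add: "supp R (x \<oplus>\<^bsub>free_module R\<^esub> y) \<subseteq> supp R x \<union> supp R y"
  by (auto simp: supp_def)

lemma supp_smult: "a \<in> carrier R \<Longrightarrow> supp R (a \<odot>\<^bsub>free_module R\<^esub> x) \<subseteq> supp R x"
  by (auto simp: supp_def)

lemma module_free: "module R (free_module R)"
proof (subst free_module_eq, rule module_pointwise[OF module_regular])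
  fix x y assume "x \<in> carrier (free_module R)" "y \<in> carrier (free_module R)"
  then show "(\<lambda>c\<in>carrier R. x c \<oplus>\<^bsub>regular_module R\<^esub> y c) \<in> carrier (free_module R)"
    using finite_subset[OF supp_add[of x y]] by (auto simp: carrier_free_module)
next
  fix a x assume "a \<in> carrier R" "x \<in> carrier (free_module R)"
  then show "(\<lambda>c\<in>carrier R. a \<odot>\<^bsub>regular_module R\<^esub> x c) \<in> carrier (free_module R)"
    using finite_subset[OF supp_smult[of a x]] by (auto simp: carrier_free_module)
qed (auto simp: carrier_free_module supp_def)

lemma free_gen_closed: "a \<in> carrier R \<Longrightarrow> free_gen R a \<in> carrier (free_module R)"
  by (auto simp: carrier_free_module free_gen_def supp_def)

lemma free_module_generated:
  assumes H: "submodule H R (free_module R)"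
    and gen: "\<And>a. a \<in> carrier R \<Longrightarrow> free_gen R a \<in> H"
    and x: "x \<in> carrier (free_module R)"
  shows "x \<in> H"
proof -
  interpret X: module R "free_module R" by (rule module_free)
  \<comment> \<open>Induction runs over a finite set bounding the support, so the coordinate split
    off at each stage is allowed to vanish.\<close>
  have "x \<in> H" if "finite S" "supp R x \<subseteq> S" "x \<in> carrier (free_module R)" for S x
    using that
  proof (induction S arbitrary: x rule: finite_induct)
    case empty
    then have "x = \<zero>\<^bsub>free_module R\<^esub>"
      by (intro extensionalityI[of _ "carrier R"]) (auto simp: supp_def carrier_free_module PiE_def)
    moreover have "\<zero>\<^bsub>free_module R\<^esub> \<in> H"
      using subgroup.one_closed[OF submodule.axioms(1)[OF H]] by simp
    ultimately show ?case by (simp only:)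
  next
    case (insert a S)
    show ?case
    \<comment> \<open>The bound \<open>S\<close> is not confined to the carrier; an index outside it
      cannot belong to the support and is simply dropped.\<close>
    proof (cases "a \<in> carrier R")
      case False
      with insert.prems show ?thesis by (intro insert.IH) (auto simp: supp_def)
    next
      case a: True
      note xc = free_module_closed[OF insert.prems(2)]
      \<comment> \<open>\<open>y\<close> is \<open>x\<close> with its coordinate at \<open>a\<close>
        erased, so that \<open>x\<close> is \<open>y\<close> plus a multiple of the generator at
        \<open>a\<close>.\<close>
      define y where "y = (\<lambda>c\<in>carrier R. if c = a then \<zero> else x c)"
      have supp_y: "supp R y \<subseteq> S" "supp R y \<subseteq> supp R x"
        using insert.prems(1) by (auto simp: supp_def y_def split: if_splits)
      have "y \<in> carrier (free_module R)"
        using xc insert.prems(2) finite_subset[OF supp_y(2)]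
        by (auto simp: carrier_free_module y_def)
      then have "y \<in> H" by (intro insert.IH supp_y)
      moreover have "x a \<odot>\<^bsub>free_module R\<^esub> free_gen R a \<in> H"
        by (rule X.submoduleE(4)[OF H xc[OF a] gen[OF a]])
      moreover have "x = y \<oplus>\<^bsub>free_module R\<^esub> (x a \<odot>\<^bsub>free_module R\<^esub> free_gen R a)"
        using insert.prems(2) xc
        by (intro extensionalityI[of _ "carrier R"])
          (auto simp: carrier_free_module PiE_def y_def free_gen_def a)
      ultimately show ?thesis
        using X.submoduleE(5)[OF H] by metis
    qed
  qed
  then show ?thesis using x by (auto simp: carrier_free_module)
qed

end

lemma free_module_lift:
  assumes U: "module A U" and h: "h \<in> carrier A \<rightarrow> carrier U"
  obtains f where "f \<in> mod_hom A (free_module A) U"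
    "\<And>a. a \<in> carrier A \<Longrightarrow> f (free_gen A a) = h a"
proof
  interpret U: module A U by (rule U)
  interpret X: module A "free_module A" by (rule U.R.module_free)
  define f where "f = (\<lambda>x\<in>carrier (free_module A). \<Oplus>\<^bsub>U\<^esub>a\<in>supp A x. x a \<odot>\<^bsub>U\<^esub> h a)"
  have hc [simp]: "h a \<in> carrier U" if "a \<in> carrier A" for a using that h by auto
  \<comment> \<open>The defining sum may be taken over any larger finite index set. Supports can
    shrink under addition and scaling, so linearity is checked over a common index set
    instead.\<close>
  have f_eq: "f x = (\<Oplus>\<^bsub>U\<^esub>a\<in>S. x a \<odot>\<^bsub>U\<^esub> h a)"
    if x: "x \<in> carrier (free_module A)" and S: "finite S" "supp A x \<subseteq> S" "S \<subseteq> carrier A" for x S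
  proof -
    have "(\<Oplus>\<^bsub>U\<^esub>a\<in>supp A x. x a \<odot>\<^bsub>U\<^esub> h a) = (\<Oplus>\<^bsub>U\<^esub>a\<in>S. x a \<odot>\<^bsub>U\<^esub> h a)"
      using S free_module_closed[OF x]
      by (intro U.M.add.finprod_mono_neutral_cong_left) (auto simp: supp_def subset_iff)
    then show ?thesis using x by (simp add: f_def)
  qed
  have supp_sub: "supp A x \<subseteq> carrier A" for x by (auto simp: supp_def)
  have fin: "finite (supp A x)" if "x \<in> carrier (free_module A)" for x
    using that by (simp add: carrier_free_module)
  show "f \<in> mod_hom A (free_module A) U"
  proof (rule mod_homI)
    show "f \<in> carrier (free_module A) \<rightarrow>\<^sub>E carrier U"
      by (auto simp: f_def free_module_closed supp_def intro!: U.M.finsum_closed)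
  next
    fix x y assume xy: "x \<in> carrier (free_module A)" "y \<in> carrier (free_module A)"
    let ?S = "supp A x \<union> supp A y"
    have S: "finite ?S" "?S \<subseteq> carrier A" using fin xy supp_sub by auto
    have "f (x \<oplus>\<^bsub>free_module A\<^esub> y) = (\<Oplus>\<^bsub>U\<^esub>a\<in>?S. (x \<oplus>\<^bsub>free_module A\<^esub> y) a \<odot>\<^bsub>U\<^esub> h a)"
      using xy S U.R.supp_add by (intro f_eq X.M.a_closed) auto
    also have "\<dots> = (\<Oplus>\<^bsub>U\<^esub>a\<in>?S. x a \<odot>\<^bsub>U\<^esub> h a \<oplus>\<^bsub>U\<^esub> y a \<odot>\<^bsub>U\<^esub> h a)"
      using S xy by (intro U.M.finsum_cong')
        (auto simp: free_module_closed subset_iff U.smult_l_distr)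
    also have "\<dots> = (\<Oplus>\<^bsub>U\<^esub>a\<in>?S. x a \<odot>\<^bsub>U\<^esub> h a) \<oplus>\<^bsub>U\<^esub> (\<Oplus>\<^bsub>U\<^esub>a\<in>?S. y a \<odot>\<^bsub>U\<^esub> h a)"
      using S xy by (intro U.M.finsum_addf) (auto simp: free_module_closed subset_iff)
    also have "\<dots> = f x \<oplus>\<^bsub>U\<^esub> f y" using xy S by (simp add: f_eq[of _ ?S])
    finally show "f (x \<oplus>\<^bsub>free_module A\<^esub> y) = f x \<oplus>\<^bsub>U\<^esub> f y" .
  next
    fix a x assume a: "a \<in> carrier A" and x: "x \<in> carrier (free_module A)"
    have "f (a \<odot>\<^bsub>free_module A\<^esub> x) = (\<Oplus>\<^bsub>U\<^esub>c\<in>supp A x. (a \<odot>\<^bsub>free_module A\<^esub> x) c \<odot>\<^bsub>U\<^esub> h c)"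
      by (intro f_eq X.smult_closed a x fin supp_sub U.R.supp_smult)
    also have "\<dots> = (\<Oplus>\<^bsub>U\<^esub>c\<in>supp A x. a \<odot>\<^bsub>U\<^esub> (x c \<odot>\<^bsub>U\<^esub> h c))"
      using a x supp_sub[of x] by (intro U.M.finsum_cong')
        (auto simp: free_module_closed subset_iff U.smult_assoc1)
    also have "\<dots> = a \<odot>\<^bsub>U\<^esub> f x"
      using a x fin supp_sub[of x]
      by (simp add: f_def free_module_closed subset_iff U.finsum_smult_ldistr[symmetric])
    finally show "f (a \<odot>\<^bsub>free_module A\<^esub> x) = a \<odot>\<^bsub>U\<^esub> f x" .
  qed
  show "f (free_gen A a) = h a" if a: "a \<in> carrier A" for a
  proof -
    \<comment> \<open>The index set \<open>{a}\<close> only needs to contain the support; in the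
      zero ring that support is empty.\<close>
    have "f (free_gen A a) = (\<Oplus>\<^bsub>U\<^esub>c\<in>{a}. free_gen A a c \<odot>\<^bsub>U\<^esub> h c)"
      by (intro f_eq U.R.free_gen_closed a) (auto simp: supp_def free_gen_def a)
    also have "\<dots> = h a" using a by (simp add: free_gen_def)
    finally show ?thesis .
  qed
qed

lemma free_module_hom_eqI:
  assumes U: "module A U" and f: "f \<in> mod_hom A (free_module A) U"
    and g: "g \<in> mod_hom A (free_module A) U"
    and gen: "\<And>a. a \<in> carrier A \<Longrightarrow> f (free_gen A a) = g (free_gen A a)"
  shows "f = g"
proof -
  interpret U: module A U by (rule U)
  interpret X: module A "free_module A" by (rule U.R.module_free)
  have "x \<in> {x \<in> carrier (free_module A). f x = g x}" if "x \<in> carrier (free_module A)" for x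
    using X.submodule_equalizer[OF U f g] _ that
    by (rule U.R.free_module_generated) (simp add: gen U.R.free_gen_closed)
  then show ?thesis
    using mod_hom_PiE[OF f] mod_hom_PiE[OF g]
    by (intro extensionalityI[of _ "carrier (free_module A)"]) (auto simp: PiE_def)
qed


section \<open>The module of differentials\<close>

text \<open>Translates the vanishing of a Leibniz relation into the Leibniz rule.\<close>

lemma (in abelian_group) minus_minus_eq_zero_iff:
  assumes "x \<in> carrier G" "y \<in> carrier G" "z \<in> carrier G"
  shows "x \<ominus> y \<ominus> z = \<zero> \<longleftrightarrow> x = y \<oplus> z"
proof -
  have "x \<ominus> y \<ominus> z = x \<oplus> \<ominus> (y \<oplus> z)"
    using assms by (simp add: a_minus_def minus_add a_assoc)
  then show ?thesis
    using assms by (simp add: add.inv_solve_right')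
qed

text \<open>The generating set inside \<open>relations\<close>, named separately so that a map can
  be tested on it before passing to the hull.\<close>

definition relators :: "('a, 'k) ring_scheme \<Rightarrow> ('r, 'l) monoid_scheme \<Rightarrow> ('r \<Rightarrow> 'a) \<Rightarrow> ('a \<Rightarrow> 'a) set"
  where "relators A R \<alpha> = {free_gen A (\<alpha> r) | r. r \<in> carrier R} \<union>
    {free_gen A (a \<otimes>\<^bsub>A\<^esub> b) \<ominus>\<^bsub>free_module A\<^esub> a \<odot>\<^bsub>free_module A\<^esub> free_gen A b
      \<ominus>\<^bsub>free_module A\<^esub> b \<odot>\<^bsub>free_module A\<^esub> free_gen A a | a b. a \<in> carrier A \<and> b \<in> carrier A}"

context
  fixes A :: "('a, 'k) ring_scheme" and R :: "('r, 'l) monoid_scheme" and \<alpha> :: "'r \<Rightarrow> 'a"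
  assumes A: "cring A" and \<alpha>: "\<alpha> \<in> carrier R \<rightarrow> carrier A"
begin

interpretation A: cring A by (rule A)
interpretation X: module A "free_module A" by (rule A.module_free)

lemma \<alpha>_closed: "r \<in> carrier R \<Longrightarrow> \<alpha> r \<in> carrier A"
  using \<alpha> by auto

lemma relators_closed: "relators A R \<alpha> \<subseteq> carrier (free_module A)"
proof -
  have "free_gen A (a \<otimes>\<^bsub>A\<^esub> b) \<ominus>\<^bsub>free_module A\<^esub> a \<odot>\<^bsub>free_module A\<^esub> free_gen A b \<ominus>\<^bsub>free_module A\<^esub> b \<odot>\<^bsub>free_module A\<^esub> free_gen A a \<in> carrier (free_module A)"
    if "a \<in> carrier A" "b \<in> carrier A" for a b
    by (intro X.M.minus_closed X.smult_closed A.free_gen_closed A.m_closed that)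
  then show ?thesis
    by (auto simp: relators_def A.free_gen_closed \<alpha>_closed simp del: free_module_simps)
qed

lemma relations_eq: "relations A R \<alpha> = (\<lambda>N. submodule N A (free_module A)) hull (relators A R \<alpha>)"
  by (simp add: relations_def relators_def Let_def)

lemma submodule_relations: "submodule (relations A R \<alpha>) A (free_module A)"
  unfolding relations_eq by (rule X.submodule_hull[OF relators_closed])

lemma relators_zero_iff_derivation:
  assumes U: "module A U" and f: "f \<in> mod_hom A (free_module A) U"
  shows "(\<forall>x\<in>relators A R \<alpha>. f x = \<zero>\<^bsub>U\<^esub>) \<longleftrightarrow> (\<lambda>a\<in>carrier A. f (free_gen A a)) \<in> derivations A R \<alpha> U"
proof -
  interpret U: module A U by (rule U)
  have leibniz: "f (free_gen A (a \<otimes>\<^bsub>A\<^esub> b) \<ominus>\<^bsub>free_module A\<^esub> a \<odot>\<^bsub>free_module A\<^esub> free_gen A b \<ominus>\<^bsub>free_module A\<^esub> b \<odot>\<^bsub>free_module A\<^esub> free_gen A a) = \<zero>\<^bsub>U\<^esub>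
      \<longleftrightarrow> f (free_gen A (a \<otimes>\<^bsub>A\<^esub> b)) = a \<odot>\<^bsub>U\<^esub> f (free_gen A b) \<oplus>\<^bsub>U\<^esub> b \<odot>\<^bsub>U\<^esub> f (free_gen A a)"
    if "a \<in> carrier A" "b \<in> carrier A" for a b
  proof -
    note cl = A.free_gen_closed[OF that(1)] A.free_gen_closed[OF that(2)]
      A.free_gen_closed[OF A.m_closed[OF that]] X.smult_closed X.M.minus_closed that
    \<comment> \<open>The coordinate formulas \<open>free_module_simps\<close> are kept out, since
      they would hide the module operations on which linearity of \<open>f\<close> acts.\<close>
    have "f (free_gen A (a \<otimes>\<^bsub>A\<^esub> b) \<ominus>\<^bsub>free_module A\<^esub> a \<odot>\<^bsub>free_module A\<^esub> free_gen A b \<ominus>\<^bsub>free_module A\<^esub> b \<odot>\<^bsub>free_module A\<^esub> free_gen A a)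
        = f (free_gen A (a \<otimes>\<^bsub>A\<^esub> b)) \<ominus>\<^bsub>U\<^esub> a \<odot>\<^bsub>U\<^esub> f (free_gen A b) \<ominus>\<^bsub>U\<^esub> b \<odot>\<^bsub>U\<^esub> f (free_gen A a)"
      by (simp add: cl mod_hom_minus[OF X.module_axioms U f] mod_hom_smult[OF f]
          del: free_module_simps)
    moreover have "f (free_gen A a) \<in> carrier U" "f (free_gen A b) \<in> carrier U" "f (free_gen A (a \<otimes>\<^bsub>A\<^esub> b)) \<in> carrier U"
      using mod_hom_closed[OF f] cl(1-3) by auto
    ultimately show ?thesis
      using that by (simp add: U.M.minus_minus_eq_zero_iff)
  qed
  have "(\<forall>x\<in>relators A R \<alpha>. f x = \<zero>\<^bsub>U\<^esub>) \<longleftrightarrow>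
      (\<forall>r\<in>carrier R. f (free_gen A (\<alpha> r)) = \<zero>\<^bsub>U\<^esub>) \<and>
      (\<forall>a\<in>carrier A. \<forall>b\<in>carrier A. f (free_gen A (a \<otimes>\<^bsub>A\<^esub> b)
        \<ominus>\<^bsub>free_module A\<^esub> a \<odot>\<^bsub>free_module A\<^esub> free_gen A b
        \<ominus>\<^bsub>free_module A\<^esub> b \<odot>\<^bsub>free_module A\<^esub> free_gen A a) = \<zero>\<^bsub>U\<^esub>)"
    unfolding relators_def by blast
  also have "\<dots> \<longleftrightarrow> (\<forall>r\<in>carrier R. f (free_gen A (\<alpha> r)) = \<zero>\<^bsub>U\<^esub>) \<and>
      (\<forall>a\<in>carrier A. \<forall>b\<in>carrier A. f (free_gen A (a \<otimes>\<^bsub>A\<^esub> b))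
        = a \<odot>\<^bsub>U\<^esub> f (free_gen A b) \<oplus>\<^bsub>U\<^esub> b \<odot>\<^bsub>U\<^esub> f (free_gen A a))"
    using leibniz by (simp cong: ball_cong del: free_module_simps)
  also have "\<dots> \<longleftrightarrow> (\<lambda>a\<in>carrier A. f (free_gen A a)) \<in> derivations A R \<alpha> U"
    using mod_hom_closed[OF f A.free_gen_closed] by (auto simp: derivations_def \<alpha>_closed)
  finally show ?thesis .
qed

text \<open>The kernel of \<open>f\<close> is a submodule containing the generating relations, hence
  contains the smallest such submodule.\<close>

lemma relations_zero:
  assumes U: "module A U" and f: "f \<in> mod_hom A (free_module A) U"
    and D: "(\<lambda>a\<in>carrier A. f (free_gen A a)) \<in> derivations A R \<alpha> U" and x: "x \<in> relations A R \<alpha>"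
  shows "f x = \<zero>\<^bsub>U\<^esub>"
proof -
  have "relators A R \<alpha> \<subseteq> {x \<in> carrier (free_module A). f x = \<zero>\<^bsub>U\<^esub>}"
    using relators_zero_iff_derivation[OF U f] D relators_closed by auto
  then have "relations A R \<alpha> \<subseteq> {x \<in> carrier (free_module A). f x = \<zero>\<^bsub>U\<^esub>}"
    unfolding relations_eq by (rule hull_minimal) (rule X.submodule_kernel[OF U f])
  then show ?thesis using x by blast
qed

lemma module_Omega: "module A (Omega A R \<alpha>)"
  unfolding Omega_def by (rule module_quotient[OF A.module_free submodule_relations])

lemma univ_der_derivation: "univ_der A R \<alpha> \<in> derivations A R \<alpha> (Omega A R \<alpha>)"
proof -
  let ?p = "\<lambda>x\<in>carrier (free_module A). relations A R \<alpha> +>\<^bsub>free_module A\<^esub> x"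
  have p: "?p \<in> mod_hom A (free_module A) (Omega A R \<alpha>)"
    unfolding Omega_def by (rule coset_mod_hom[OF A.module_free submodule_relations])
  have "?p x = \<zero>\<^bsub>Omega A R \<alpha>\<^esub>" if "x \<in> relators A R \<alpha>" for x
    using that relators_closed hull_inc[of x "relators A R \<alpha>"]
      coset_eq_zero_iff[OF A.module_free submodule_relations, of x]
    by (auto simp: Omega_def relations_eq)
  then have "(\<lambda>a\<in>carrier A. ?p (free_gen A a)) \<in> derivations A R \<alpha> (Omega A R \<alpha>)"
    using relators_zero_iff_derivation[OF module_Omega p] by blast
  also have "(\<lambda>a\<in>carrier A. ?p (free_gen A a)) = univ_der A R \<alpha>"
    by (auto simp: univ_der_def A.free_gen_closed fun_eq_iff)
  finally show ?thesis .
qed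

lemma carrier_Omega: "carrier (Omega A R \<alpha>) = (\<lambda>x. relations A R \<alpha> +>\<^bsub>free_module A\<^esub> x) ` carrier (free_module A)"
  unfolding Omega_def by (rule carrier_quotient_module[OF A.module_free submodule_relations])

text \<open>Both maps are pulled back along the projection \<open>?p\<close>. The pullbacks agree on
  the free generators, hence everywhere, and surjectivity of \<open>?p\<close> gives equality on
  \<Omega>.\<close>

lemma Omega_hom_eqI:
  assumes U: "module A U" and f: "f \<in> mod_hom A (Omega A R \<alpha>) U" and g: "g \<in> mod_hom A (Omega A R \<alpha>) U"
    and eq: "compose (carrier A) f (univ_der A R \<alpha>) = compose (carrier A) g (univ_der A R \<alpha>)"
  shows "f = g"
proof -
  let ?p = "\<lambda>x\<in>carrier (free_module A). relations A R \<alpha> +>\<^bsub>free_module A\<^esub> x"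
  have p: "?p \<in> mod_hom A (free_module A) (Omega A R \<alpha>)"
    unfolding Omega_def by (rule coset_mod_hom[OF A.module_free submodule_relations])
  have "compose (carrier (free_module A)) f ?p = compose (carrier (free_module A)) g ?p"
  proof (rule free_module_hom_eqI[OF U mod_hom_compose[OF p f A.module_free]
        mod_hom_compose[OF p g A.module_free]])
    fix a assume "a \<in> carrier A"
    then show "compose (carrier (free_module A)) f ?p (free_gen A a) = compose (carrier (free_module A)) g ?p (free_gen A a)"
      using fun_cong[OF eq, of a] by (simp add: compose_def univ_der_def A.free_gen_closed)
  qed
  then have "f (relations A R \<alpha> +>\<^bsub>free_module A\<^esub> x) = g (relations A R \<alpha> +>\<^bsub>free_module A\<^esub> x)" if "x \<in> carrier (free_module A)" for x
    using that by (auto simp: compose_def dest: fun_cong[of _ _ x])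
  then show ?thesis
    using mod_hom_PiE[OF f] mod_hom_PiE[OF g]
    by (intro extensionalityI[of _ "carrier (Omega A R \<alpha>)"]) (auto simp: PiE_def carrier_Omega)
qed

lemma Omega_lift:
  assumes U: "module A U" and D: "D \<in> derivations A R \<alpha> U"
  obtains g where "g \<in> mod_hom A (Omega A R \<alpha>) U" "compose (carrier A) g (univ_der A R \<alpha>) = D"
proof -
  have D_fun: "D \<in> carrier A \<rightarrow> carrier U" and D_ext: "D \<in> extensional (carrier A)"
    using subsetD[OF derivations_subset D] by (simp_all add: PiE_def)
  obtain f where f: "f \<in> mod_hom A (free_module A) U" and fe: "\<And>a. a \<in> carrier A \<Longrightarrow> f (free_gen A a) = D a"
    using free_module_lift[OF U D_fun] by blast
  \<comment> \<open>Reading \<open>f\<close> on the generators returns \<open>D\<close> exactly, so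
    the derivation property of \<open>D\<close> is what makes \<open>f\<close> vanish on the
    relations.\<close>
  have "(\<lambda>a\<in>carrier A. f (free_gen A a)) = D"
    using D_ext by (intro extensionalityI[of _ "carrier A"]) (auto simp: fe)
  then have ker: "f x = \<zero>\<^bsub>U\<^esub>" if "x \<in> relations A R \<alpha>" for x
    using relations_zero[OF U f _ that] D by simp
  obtain g where g: "g \<in> mod_hom A (Omega A R \<alpha>) U"
    and gf: "\<And>x. x \<in> carrier (free_module A) \<Longrightarrow> g (relations A R \<alpha> +>\<^bsub>free_module A\<^esub> x) = f x"
    using quotient_module_lift[OF A.module_free submodule_relations U f ker]
    unfolding Omega_def by blast
  have "compose (carrier A) g (univ_der A R \<alpha>) = D"
    using D_ext by (intro extensionalityI[of _ "carrier A"])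
      (auto simp: compose_def univ_der_def gf fe A.free_gen_closed)
  with g show thesis by (rule that)
qed

section \<open>The natural isomorphism and initiality\<close>

lemma compose_univ_der_derivation:
  assumes U: "module A U" and f: "f \<in> mod_hom A (Omega A R \<alpha>) U"
  shows "compose (carrier A) f (univ_der A R \<alpha>) \<in> derivations A R \<alpha> U"
  by (rule mod_hom_compose_derivation[OF module_Omega U \<alpha> f univ_der_derivation])

lemma eta_eq: "eta A R \<alpha> U = (\<lambda>\<psi>\<in>mod_hom A (Omega A R \<alpha>) U. compose (carrier A) \<psi> (univ_der A R \<alpha>))"
  by (simp add: eta_def)

text \<open>Linearity is that of precomposition; injectivity is \<open>Omega_hom_eqI\<close> and
  surjectivity is \<open>Omega_lift\<close>.\<close>

lemma eta_mod_iso: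
  assumes U: "module A U"
  shows "eta A R \<alpha> U \<in> mod_iso A (Hom_module A (Omega A R \<alpha>) U) (Der A R \<alpha> U)"
proof -
  have "eta A R \<alpha> U \<in> mod_hom A (Hom_module A (Omega A R \<alpha>) U) (Der A R \<alpha> U)"
    unfolding eta_eq Hom_module_def Der_def
    using derivations_closed[OF univ_der_derivation] compose_univ_der_derivation[OF U]
      module_Hom[OF module_Omega U]
    by (intro precompose_mod_hom) (auto simp: Hom_module_def)
  moreover have "bij_betw (eta A R \<alpha> U) (mod_hom A (Omega A R \<alpha>) U) (derivations A R \<alpha> U)"
    unfolding bij_betw_def
  proof
    show "inj_on (eta A R \<alpha> U) (mod_hom A (Omega A R \<alpha>) U)"
      by (rule inj_onI) (auto simp: eta_eq intro: Omega_hom_eqI[OF U])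
    show "eta A R \<alpha> U ` mod_hom A (Omega A R \<alpha>) U = derivations A R \<alpha> U"
    proof
      show "derivations A R \<alpha> U \<subseteq> eta A R \<alpha> U ` mod_hom A (Omega A R \<alpha>) U"
      proof
        fix D assume "D \<in> derivations A R \<alpha> U"
        then obtain g where "g \<in> mod_hom A (Omega A R \<alpha>) U"
          "compose (carrier A) g (univ_der A R \<alpha>) = D"
          using Omega_lift[OF U] by blast
        then show "D \<in> eta A R \<alpha> U ` mod_hom A (Omega A R \<alpha>) U"
          by (intro image_eqI[of _ _ g]) (simp_all add: eta_eq)
      qed
    qed (auto simp: eta_eq compose_univ_der_derivation[OF U])
  qed
  ultimately show ?thesis by (simp add: mod_iso_def)
qed

text \<open>Naturality is associativity of composition. For extensional functions this requires the
  universal derivation to take values in the carrier of \<Omega>.\<close>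

lemma eta_natural:
  assumes U: "module A U" and V: "module A V" and f: "f \<in> mod_hom A U V"
  shows "compose (carrier (Hom_module A (Omega A R \<alpha>) U)) (eta A R \<alpha> V) (Hom_map A (Omega A R \<alpha>) U f)
    = compose (carrier (Hom_module A (Omega A R \<alpha>) U)) (Der_map A R \<alpha> U f) (eta A R \<alpha> U)"
proof -
  have "compose (carrier A) (compose (carrier (Omega A R \<alpha>)) f \<psi>) (univ_der A R \<alpha>)
      = compose (carrier A) f (compose (carrier A) \<psi> (univ_der A R \<alpha>))" for \<psi>
    using derivations_closed[OF univ_der_derivation] by (intro compose_assoc[symmetric]) auto
  then show ?thesis
    using mod_hom_compose[OF _ f module_Omega] compose_univ_der_derivation[OF U]
    by (auto simp: eta_eq Hom_map_def Der_map_def compose_def[of "mod_hom A (Omega A R \<alpha>) U"]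
        fun_eq_iff)
qed

lemma initial_Omega:
  "initial_differential_module TYPE('v) A R \<alpha> (Omega A R \<alpha>, univ_der A R \<alpha>)"
  unfolding initial_differential_module_def
proof (intro conjI allI impI)
  show "differential_module A R \<alpha> (Omega A R \<alpha>, univ_der A R \<alpha>)"
    by (simp add: differential_module_def module_Omega univ_der_derivation)
next
  fix Q :: "('a, 'v) module \<times> ('a \<Rightarrow> 'v)"
  assume "differential_module A R \<alpha> Q"
  then obtain U D where Q: "Q = (U, D)" and U: "module A U" and D: "D \<in> derivations A R \<alpha> U"
    by (cases Q) (auto simp: differential_module_def)
  obtain g where g: "g \<in> mod_hom A (Omega A R \<alpha>) U"
    "compose (carrier A) g (univ_der A R \<alpha>) = D"
    using Omega_lift[OF U D] .
  show "\<exists>!f. f \<in> differential_hom A (Omega A R \<alpha>, univ_der A R \<alpha>) Q"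
  proof (rule ex1I[of _ g])
    show "g \<in> differential_hom A (Omega A R \<alpha>, univ_der A R \<alpha>) Q"
      using g by (simp add: differential_hom_def Q)
    fix f assume "f \<in> differential_hom A (Omega A R \<alpha>, univ_der A R \<alpha>) Q"
    then show "f = g"
      using g by (auto simp: differential_hom_def Q intro!: Omega_hom_eqI[OF U])
  qed
qed

end

theorem lemma5p3:
  fixes A :: "('a, 'k) ring_scheme" and R :: "('r, 'l) monoid_scheme" and \<alpha> :: "'r \<Rightarrow> 'a"
  assumes "cring A"
    and "comm_monoid R"
    and "\<alpha> \<in> hom R A" and "\<alpha> \<one>\<^bsub>R\<^esub> = \<one>\<^bsub>A\<^esub>"
  shows "(\<forall>U :: ('a, 'u) module. module A U \<longrightarrow>
            module A (Hom_module A (Omega A R \<alpha>) U) \<and>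
            module A (Der A R \<alpha> U) \<and>
            eta A R \<alpha> U \<in> mod_iso A (Hom_module A (Omega A R \<alpha>) U) (Der A R \<alpha> U))
       \<and> (\<forall>(U :: ('a, 'u) module) (V :: ('a, 'v) module) f.
            module A U \<longrightarrow> module A V \<longrightarrow> f \<in> mod_hom A U V \<longrightarrow>
            compose (carrier (Hom_module A (Omega A R \<alpha>) U))
              (eta A R \<alpha> V) (Hom_map A (Omega A R \<alpha>) U f) =
            compose (carrier (Hom_module A (Omega A R \<alpha>) U))
              (Der_map A R \<alpha> U f) (eta A R \<alpha> U))
       \<and> represents A (Omega A R \<alpha>)
            (Der A R \<alpha> :: ('a, 'u) module \<Rightarrow> _) (Der_map A R \<alpha>)
       \<and> initial_differential_module TYPE('u) A R \<alpha> (Omega A R \<alpha>, univ_der A R \<alpha>)"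
proof -
  have \<alpha>: "\<alpha> \<in> carrier R \<rightarrow> carrier A"
    using assms(3) by (auto simp: hom_def)
  note \<Omega> = module_Omega[OF assms(1) \<alpha>] and iso = eta_mod_iso[OF assms(1) \<alpha>]
    and natural = eta_natural[OF assms(1) \<alpha>]
  \<comment> \<open>The natural isomorphism demanded here is \<open>eta\<close>; its naturality,
    proved for modules with different element types, is specialized to the single type
    \<open>'u\<close>.\<close>
  have "represents A (Omega A R \<alpha>) (Der A R \<alpha> :: ('a, 'u) module \<Rightarrow> _) (Der_map A R \<alpha>)"
    unfolding represents_def natural_iso_def
    using \<Omega> module_functor_Der[OF \<alpha>] module_functor_Hom[OF \<Omega>] iso natural by blast
  then show ?thesis
    using module_Hom[OF \<Omega>] module_Der[OF _ \<alpha>] iso natural initial_Omega[OF assms(1) \<alpha>] by blast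
qed

end
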